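(* (a) Spoiler can win the $3$-round MS game on $(\{\mathsf{RT}(4)\},\{\mathsf{RT}(3)\})$ without playing on top. (b) There is no first-order sentence $\psi$ with $3$ quantifiers such that $\psi$ is a separating sentence for $(\{\mathsf{RT}(4)\},\{\mathsf{RT}(3)\})$ and both $\psi$ and $\neg\psi$ are non-replicating sentences.
   Context: Schema: one binary relation symbol $<$, no constants. $\mathsf{RT}(4)$: rooted tree with nodes $B1,B11,B12,B13,B21,B22$, root $B1$, edges $B1$–$B11$, $B11$–$B12$, $B12$–$B13$, $B1$–$B21$, $B21$–$B22$. $\mathsf{RT}(3)$: rooted tree with nodes $L1,L11,L12,L21,L22$, root $L1$, edges $L1$–$L11$, $L11$–$L12$, $L1$–$L21$, $L21$–$L22$. $x<y$ iff $x$ is a proper descendant of $y$. A separating sentence for $(\mathcal{A},\mathcal{B})$ is true on all of $\mathcal{A}$ and false on all of $\mathcal{B}$. A type over distinct variables $x_1,\dots,x_r$ is a (consistent) conjunction of atomic and negated atomic formulas containing, for each atomic formula in these variables, exactly one of it or its negation. Sentences with $r$ quantifiers are taken in the form $\psi=Q_1x_1\dots Q_rx_r\,\theta$, $\theta$ a disjunction of types; $\neg\psi$ is $\overline{Q_1}x_1\dots\overline{Q_r}x_r\,\theta'$ with dual quantifiers and $\theta'$ the disjunction of the consistent types not in $\theta$. A disjunct type $t$ of $\theta$ is non-replicating in $\psi$ if each equality $x_i=x_j$ ($i\ne j$) in $t$ has either both variables universally quantified, or one universal and one existential with the existential occurring earlier in the prefix (and each equality $c=x_j$ with $c$ a constant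 has $x_j$ universal). $\psi$ is non-replicating if all disjuncts of $\theta$ are non-replicating in $\psi$. MS game: pebbled structures carry pebble $i$ on element $a_i$; two form a matching pair if $a_i\mapsto b_i$ is an isomorphism of induced substructures. In the $r$-round MS game on $(\mathcal{A},\mathcal{B})$, in each round $t$ Spoiler picks a side and places pebble $t$ on an element of each pebbled structure there; Duplicator, for each pebbled structure on the other side, may make any number of copies and places pebble $t$ on an element of each copy; Spoiler wins once no left structure forms a matching pair with a right one; Duplicator wins if a matching pair remains after round $r$. Spoiler plays on top if he places a pebble on an element already carrying a pebble. *)

theory Defs
  imports Main
begin

section \<open>Structures with one binary relation and the two trees\<close>

record 'a bstruct =
  univ :: "'a set"
  lt :: "'a \<Rightarrow> 'a \<Rightarrow> bool"

datatype node4 = B1 | B11 | B12 | B13 | B21 | B22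

datatype node3 = L1 | L11 | L12 | L21 | L22

text \<open>Edges are oriented towards the root, as (child, parent), so that the transitive closure
  is the proper-descendant relation.\<close>

definition child4 :: "node4 rel" where
  "child4 = {(B11, B1), (B12, B11), (B13, B12), (B21, B1), (B22, B21)}"

definition child3 :: "node3 rel" where
  "child3 = {(L11, L1), (L12, L11), (L21, L1), (L22, L21)}"

definition RT4 :: "node4 bstruct" where
  "RT4 = \<lparr>univ = UNIV, lt = (\<lambda>x y. (x, y) \<in> child4\<^sup>+)\<rparr>"

definition RT3 :: "node3 bstruct" where
  "RT3 = \<lparr>univ = UNIV, lt = (\<lambda>x y. (x, y) \<in> child3\<^sup>+)\<rparr>"

section \<open>The multi-structural game\<close>

text \<open>Pebble \<open>i\<close> lies on the \<open>i\<close>-th entry of the list (counting from 0).\<close>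

type_synonym 'a pebbled = "'a bstruct \<times> 'a list"

definition matching_pair :: "'a pebbled \<Rightarrow> 'b pebbled \<Rightarrow> bool" where
  "matching_pair p q \<longleftrightarrow>
     (\<exists>f. map f (snd p) = snd q \<and> bij_betw f (set (snd p)) (set (snd q)) \<and>
          (\<forall>x\<in>set (snd p). \<forall>y\<in>set (snd p). lt (fst p) x y \<longleftrightarrow> lt (fst q) (f x) (f y)))"

definition no_match :: "'a pebbled set \<Rightarrow> 'b pebbled set \<Rightarrow> bool" where
  "no_match A B \<longleftrightarrow> (\<forall>p\<in>A. \<forall>q\<in>B. \<not> matching_pair p q)"

text \<open>With \<open>on_top = False\<close>, Spoiler may not play on top of a pebble.\<close>

definition spoiler_move :: "bool \<Rightarrow> 'a pebbled set \<Rightarrow> ('a pebbled \<Rightarrow> 'a) \<Rightarrow> bool" where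
  "spoiler_move on_top A f \<longleftrightarrow>
     (\<forall>p\<in>A. f p \<in> univ (fst p) \<and> (on_top \<or> f p \<notin> set (snd p)))"

text \<open>The set \<open>g p\<close> holds the elements pebbled in the copies that Duplicator makes of \<open>p\<close>.
  Identical pebbled structures are identified: a second copy pebbled in the same way
  contributes no new matching pair.\<close>

definition duplicator_move :: "'a pebbled set \<Rightarrow> ('a pebbled \<Rightarrow> 'a set) \<Rightarrow> bool" where
  "duplicator_move A g \<longleftrightarrow> (\<forall>p\<in>A. g p \<noteq> {} \<and> g p \<subseteq> univ (fst p))"

definition after_spoiler :: "'a pebbled set \<Rightarrow> ('a pebbled \<Rightarrow> 'a) \<Rightarrow> 'a pebbled set" where
  "after_spoiler A f = {(fst p, snd p @ [f p]) | p. p \<in> A}"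

definition after_duplicator :: "'a pebbled set \<Rightarrow> ('a pebbled \<Rightarrow> 'a set) \<Rightarrow> 'a pebbled set" where
  "after_duplicator A g = {(fst p, snd p @ [a]) | p a. p \<in> A \<and> a \<in> g p}"

text \<open>\<open>spoiler_wins on_top r A B\<close>: Spoiler has a winning strategy from position \<open>(A, B)\<close>
  with \<open>r\<close> rounds left.\<close>

fun spoiler_wins :: "bool \<Rightarrow> nat \<Rightarrow> 'a pebbled set \<Rightarrow> 'b pebbled set \<Rightarrow> bool" where
  "spoiler_wins on_top 0 A B \<longleftrightarrow> no_match A B"
| "spoiler_wins on_top (Suc r) A B \<longleftrightarrow>
     no_match A B \<or>
     (\<exists>f. spoiler_move on_top A f \<and>
        (\<forall>g. duplicator_move B g \<longrightarrow>
           spoiler_wins on_top r (after_spoiler A f) (after_duplicator B g))) \<or>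
     (\<exists>f. spoiler_move on_top B f \<and>
        (\<forall>g. duplicator_move A g \<longrightarrow>
           spoiler_wins on_top r (after_duplicator A g) (after_spoiler B f)))"

definition initial :: "'a bstruct set \<Rightarrow> 'a pebbled set" where
  "initial \<A> = {(S, []) | S. S \<in> \<A>}"

definition spoiler_can_win :: "nat \<Rightarrow> 'a bstruct set \<Rightarrow> 'b bstruct set \<Rightarrow> bool" where
  "spoiler_can_win r \<A> \<B> \<longleftrightarrow> spoiler_wins True r (initial \<A>) (initial \<B>)"

definition spoiler_can_win_without_top ::
    "nat \<Rightarrow> 'a bstruct set \<Rightarrow> 'b bstruct set \<Rightarrow> bool" where
  "spoiler_can_win_without_top r \<A> \<B> \<longleftrightarrow> spoiler_wins False r (initial \<A>) (initial \<B>)"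

section \<open>Types and prenex sentences\<close>

text \<open>The variables of a sentence with \<open>r\<close> quantifiers are \<open>0, \<dots>, r - 1\<close>, in the order of the
  prefix; the value of variable \<open>i\<close> is the \<open>i\<close>-th entry of a list.\<close>

datatype atomic = Eq nat nat | Less nat nat

datatype literal = Pos atomic | Neg atomic

definition atoms :: "nat \<Rightarrow> atomic set" where
  "atoms r = {Eq i j | i j. i < r \<and> j < r} \<union> {Less i j | i j. i < r \<and> j < r}"

fun holds_atomic :: "'a bstruct \<Rightarrow> 'a list \<Rightarrow> atomic \<Rightarrow> bool" where
  "holds_atomic S as (Eq i j) \<longleftrightarrow> as ! i = as ! j"
| "holds_atomic S as (Less i j) \<longleftrightarrow> lt S (as ! i) (as ! j)"

fun holds_literal :: "'a bstruct \<Rightarrow> 'a list \<Rightarrow> literal \<Rightarrow> bool" where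
  "holds_literal S as (Pos a) \<longleftrightarrow> holds_atomic S as a"
| "holds_literal S as (Neg a) \<longleftrightarrow> \<not> holds_atomic S as a"

definition holds_conj :: "'a bstruct \<Rightarrow> 'a list \<Rightarrow> literal set \<Rightarrow> bool" where
  "holds_conj S as t \<longleftrightarrow> (\<forall>l\<in>t. holds_literal S as l)"

text \<open>Consistency is satisfiability in some structure. Structures on sets of naturals suffice,
  since any satisfying structure can be cut down to the at most \<open>r\<close> values of the variables.\<close>

definition consistent :: "nat \<Rightarrow> literal set \<Rightarrow> bool" where
  "consistent r t \<longleftrightarrow>
     (\<exists>(S :: nat bstruct) as. length as = r \<and> univ S \<noteq> {} \<and> set as \<subseteq> univ S \<and> holds_conj S as t)"

text \<open>A type is given by the set of its conjuncts, and the matrix of a sentence by the set of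
  its disjuncts.\<close>

definition types :: "nat \<Rightarrow> literal set set" where
  "types r = {t. t \<subseteq> Pos ` atoms r \<union> Neg ` atoms r \<and>
                 (\<forall>a\<in>atoms r. (Pos a \<in> t) \<noteq> (Neg a \<in> t)) \<and>
                 consistent r t}"

datatype quant = Exists | Forall

fun dual :: "quant \<Rightarrow> quant" where
  "dual Exists = Forall"
| "dual Forall = Exists"

record sentence =
  prefix :: "quant list"
  matrix :: "literal set set"

definition is_sentence :: "nat \<Rightarrow> sentence \<Rightarrow> bool" where
  "is_sentence r \<psi> \<longleftrightarrow> length (prefix \<psi>) = r \<and> matrix \<psi> \<subseteq> types r"

fun holds_prenex :: "'a bstruct \<Rightarrow> 'a list \<Rightarrow> quant list \<Rightarrow> literal set set \<Rightarrow> bool" where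
  "holds_prenex S as [] \<theta> \<longleftrightarrow> (\<exists>t\<in>\<theta>. holds_conj S as t)"
| "holds_prenex S as (Exists # Qs) \<theta> \<longleftrightarrow> (\<exists>a\<in>univ S. holds_prenex S (as @ [a]) Qs \<theta>)"
| "holds_prenex S as (Forall # Qs) \<theta> \<longleftrightarrow> (\<forall>a\<in>univ S. holds_prenex S (as @ [a]) Qs \<theta>)"

definition models :: "'a bstruct \<Rightarrow> sentence \<Rightarrow> bool" where
  "models S \<psi> \<longleftrightarrow> holds_prenex S [] (prefix \<psi>) (matrix \<psi>)"

definition separating :: "sentence \<Rightarrow> 'a bstruct set \<Rightarrow> 'b bstruct set \<Rightarrow> bool" where
  "separating \<psi> \<A> \<B> \<longleftrightarrow> (\<forall>S\<in>\<A>. models S \<psi>) \<and> (\<forall>S\<in>\<B>. \<not> models S \<psi>)"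

definition neg_sentence :: "sentence \<Rightarrow> sentence" where
  "neg_sentence \<psi> =
     \<lparr>prefix = map dual (prefix \<psi>), matrix = types (length (prefix \<psi>)) - matrix \<psi>\<rparr>"

definition non_replicating_type :: "sentence \<Rightarrow> literal set \<Rightarrow> bool" where
  "non_replicating_type \<psi> t \<longleftrightarrow>
     (\<forall>i j. i \<noteq> j \<and> Pos (Eq i j) \<in> t \<longrightarrow>
        (prefix \<psi> ! i = Forall \<and> prefix \<psi> ! j = Forall) \<or>
        (prefix \<psi> ! i = Exists \<and> prefix \<psi> ! j = Forall \<and> i < j) \<or>
        (prefix \<psi> ! i = Forall \<and> prefix \<psi> ! j = Exists \<and> j < i))"

definition non_replicating :: "sentence \<Rightarrow> bool" where
  "non_replicating \<psi> \<longleftrightarrow> (\<forall>t\<in>matrix \<psi>. non_replicating_type \<psi> t)"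

end

theory Submission
  imports Defs "HOL-Library.NList"
begin

text \<open>
  (a) Spoiler first plays \<open>B12\<close>, which is neither the root, nor a leaf, nor directly below the root.
  On the right he then plays, for each possible reply, an element exposing this difference: the
  root against a middle node, a middle node of the other branch against a leaf, a lower node against
  the root. In the last round he plays on the left a node that has no counterpart on the right.
  Only the Duplicator who always makes a copy for every element has to be considered, since Spoiler
  wins from every part of a position from which he wins.

  (b) Let \<open>x\<^sub>i = x\<^sub>j\<close> with \<open>i < j\<close> occur in a type \<open>t\<close>. If both \<open>\<psi>\<close> and \<open>\<not>\<psi>\<close> are non-replicating,
  then \<open>t\<close> is a disjunct of \<open>\<psi>\<close> if \<open>x\<^sub>j\<close> is universal, and of \<open>\<not>\<psi>\<close> if \<open>x\<^sub>j\<close> is existential.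
  Applied to the type in which all three variables are equal, this forces the last two quantifiers to
  coincide. Such prefixes do not separate the trees: \<open>RT3\<close> embeds into \<open>RT4\<close> through any given
  element; conversely, elements of \<open>RT4\<close> that avoid one of \<open>B11\<close>, \<open>B12\<close>, \<open>B13\<close> can be mapped back
  to \<open>RT3\<close> with \<open>B1\<close>, \<open>B21\<close>, \<open>B22\<close> going to \<open>L1\<close>, \<open>L21\<close>, \<open>L22\<close>, and the only triple that
  does not avoid any of them is a chain, which also occurs in \<open>RT3\<close>.
\<close>

section \<open>Partial embeddings and matching pairs\<close>

definition partial_embedding ::
    "'a bstruct \<Rightarrow> 'b bstruct \<Rightarrow> 'a set \<Rightarrow> ('a \<Rightarrow> 'b) \<Rightarrow> bool" where
  "partial_embedding S T X f \<longleftrightarrow>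
     inj_on f X \<and> (\<forall>x\<in>X. \<forall>y\<in>X. lt T (f x) (f y) \<longleftrightarrow> lt S x y)"

lemma partial_embedding_subset:
  assumes "partial_embedding S T X f" and "Y \<subseteq> X"
  shows "partial_embedding S T Y f"
  using assms unfolding partial_embedding_def by (blast intro: inj_on_subset)

lemma partial_embedding_comp:
  assumes "partial_embedding S T X f" and "partial_embedding T U (f ` X) g"
  shows "partial_embedding S U X (g \<circ> f)"
  using assms unfolding partial_embedding_def by (simp add: comp_inj_on)

lemma partial_embedding_inv_into:
  assumes "partial_embedding S T X f"
  shows "partial_embedding T S (f ` X) (inv_into X f)"
  using assms unfolding partial_embedding_def by (simp add: inj_on_inv_into)

lemma matching_pair_iff:
  "matching_pair (S, as) (T, bs) \<longleftrightarrow> (\<exists>f. bs = map f as \<and> partial_embedding S T (set as) f)"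
  unfolding matching_pair_def partial_embedding_def bij_betw_def by auto

lemma matching_pair_sym:
  assumes "matching_pair p q"
  shows "matching_pair q p"
proof -
  obtain S as T bs where p: "p = (S, as)" and q: "q = (T, bs)" by (cases p, cases q)
  then obtain f where bs: "bs = map f as" and f: "partial_embedding S T (set as) f"
    using assms by (auto simp: matching_pair_iff)
  have "as = map (inv_into (set as) f) bs"
    using f by (simp add: bs partial_embedding_def map_idI)
  then show ?thesis
    using partial_embedding_inv_into[OF f] unfolding p q matching_pair_iff by (auto simp: bs)
qed

lemma matching_pair_holds_atomic:
  assumes "matching_pair (S, as) (T, bs)" and "a \<in> atoms (length as)"
  shows "holds_atomic S as a \<longleftrightarrow> holds_atomic T bs a"
  using assms unfolding matching_pair_iff partial_embedding_def
  by (auto simp: atoms_def inj_on_eq_iff)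

lemma matching_pair_holds_conj:
  assumes "matching_pair (S, as) (T, bs)" and "t \<in> types (length as)"
  shows "holds_conj S as t \<longleftrightarrow> holds_conj T bs t"
proof -
  have "t \<subseteq> Pos ` atoms (length as) \<union> Neg ` atoms (length as)"
    using assms(2) by (simp add: types_def)
  then have "\<forall>l\<in>t. holds_literal S as l \<longleftrightarrow> holds_literal T bs l"
    using matching_pair_holds_atomic[OF assms(1)] by fastforce
  then show ?thesis by (simp add: holds_conj_def)
qed

section \<open>The game against an oblivious Duplicator\<close>

lemma no_match_commute: "no_match A B \<longleftrightarrow> no_match B A"
  unfolding no_match_def by (blast intro: matching_pair_sym)

lemma spoiler_wins_commute: "spoiler_wins on_top r A B \<longleftrightarrow> spoiler_wins on_top r B A"
proof (induction r arbitrary: A B)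
  case 0
  show ?case by (simp add: no_match_commute[of A])
next
  case (Suc r)
  show ?case by (auto simp: no_match_commute[of A] Suc)
qed

lemma duplicator_move_extend:
  assumes "duplicator_move A' g'" and "A' \<subseteq> A" and "\<forall>p\<in>A. univ (fst p) \<noteq> {}"
  obtains g where "duplicator_move A g" and "after_duplicator A' g' \<subseteq> after_duplicator A g"
proof
  let ?g = "\<lambda>p. if p \<in> A' then g' p else univ (fst p)"
  show "duplicator_move A ?g" using assms by (auto simp: duplicator_move_def)
  show "after_duplicator A' g' \<subseteq> after_duplicator A ?g"
    using assms(2) by (auto simp: after_duplicator_def)
qed

lemma after_spoiler_mono: "A' \<subseteq> A \<Longrightarrow> after_spoiler A' f \<subseteq> after_spoiler A f"
  by (auto simp: after_spoiler_def)

lemma nonempty_univ_after_move: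
  assumes "\<forall>p\<in>A. univ (fst p) \<noteq> {}"
  shows "\<forall>p\<in>after_spoiler A f. univ (fst p) \<noteq> {}" "\<forall>p\<in>after_duplicator A g. univ (fst p) \<noteq> {}"
  using assms by (auto simp: after_spoiler_def after_duplicator_def)

lemma spoiler_wins_left_move_mono:
  fixes A A' :: "'a pebbled set" and B B' :: "'b pebbled set"
  assumes mono: "\<And>(C :: 'a pebbled set) (D :: 'b pebbled set) C' D'.
      spoiler_wins on_top r C D \<Longrightarrow> C' \<subseteq> C \<Longrightarrow> D' \<subseteq> D \<Longrightarrow>
      \<forall>p\<in>C. univ (fst p) \<noteq> {} \<Longrightarrow> \<forall>q\<in>D. univ (fst q) \<noteq> {} \<Longrightarrow> spoiler_wins on_top r C' D'"
    and legal: "spoiler_move on_top A f"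
    and wins: "\<And>g. duplicator_move B g \<Longrightarrow>
      spoiler_wins on_top r (after_spoiler A f) (after_duplicator B g)"
    and "A' \<subseteq> A" and "B' \<subseteq> B"
    and nonempty: "\<forall>p\<in>A. univ (fst p) \<noteq> {}" "\<forall>q\<in>B. univ (fst q) \<noteq> {}"
  shows "spoiler_wins on_top (Suc r) A' B'"
proof -
  have "spoiler_move on_top A' f"
    using legal \<open>A' \<subseteq> A\<close> by (auto simp: spoiler_move_def)
  moreover have "spoiler_wins on_top r (after_spoiler A' f) (after_duplicator B' g')"
    if move: "duplicator_move B' g'" for g'
  proof -
    obtain g where g: "duplicator_move B g"
      and extends: "after_duplicator B' g' \<subseteq> after_duplicator B g"
      by (rule duplicator_move_extend[OF move \<open>B' \<subseteq> B\<close> nonempty(2)])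
    show ?thesis
      by (rule mono[OF wins[OF g] after_spoiler_mono[OF \<open>A' \<subseteq> A\<close>] extends])
        (rule nonempty_univ_after_move; fact)+
  qed
  ultimately show ?thesis by auto
qed

text \<open>Non-emptiness lets Duplicator answer on the structures that occur only in the larger
  position.\<close>

lemma spoiler_wins_mono:
  fixes A A' :: "'a pebbled set" and B B' :: "'b pebbled set"
  assumes "spoiler_wins on_top r A B" and "A' \<subseteq> A" and "B' \<subseteq> B"
    and "\<forall>p\<in>A. univ (fst p) \<noteq> {}" and "\<forall>q\<in>B. univ (fst q) \<noteq> {}"
  shows "spoiler_wins on_top r A' B'"
  using assms
proof (induction r arbitrary: A B A' B')
  case 0
  then show ?case by (auto simp: no_match_def)
next
  case (Suc r)
  from Suc.prems(1) consider (unmatched) "no_match A B"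
    | (left) f where "spoiler_move on_top A f"
      "\<And>g. duplicator_move B g \<Longrightarrow> spoiler_wins on_top r (after_spoiler A f) (after_duplicator B g)"
    | (right) f where "spoiler_move on_top B f"
      "\<And>g. duplicator_move A g \<Longrightarrow> spoiler_wins on_top r (after_duplicator A g) (after_spoiler B f)"
    by auto
  then show ?case
  proof cases
    case unmatched
    then have "no_match A' B'" using Suc.prems by (auto simp: no_match_def)
    then show ?thesis by simp
  next
    case left
    show ?thesis
      by (rule spoiler_wins_left_move_mono[OF Suc.IH left Suc.prems(2-5)])
  next
    case right
    have swapped: "spoiler_wins on_top r D' C'"
      if "spoiler_wins on_top r D C" "D' \<subseteq> D" "C' \<subseteq> C"
        "\<forall>q\<in>D. univ (fst q) \<noteq> {}" "\<forall>p\<in>C. univ (fst p) \<noteq> {}"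
      for C C' :: "'a pebbled set" and D D' :: "'b pebbled set"
      using Suc.IH[of C D C' D'] that
      by (simp add: spoiler_wins_commute[of _ _ C D] spoiler_wins_commute[of _ _ C' D'])
    have "spoiler_wins on_top r (after_spoiler B f) (after_duplicator A g)"
      if "duplicator_move A g" for g
      by (subst spoiler_wins_commute) (rule right(2)[OF that])
    from spoiler_wins_left_move_mono[OF swapped right(1) this Suc.prems(3,2,5,4)]
    show ?thesis by (subst spoiler_wins_commute)
  qed
qed

definition after_all_copies :: "'a pebbled set \<Rightarrow> 'a pebbled set" where
  "after_all_copies A = after_duplicator A (\<lambda>p. univ (fst p))"

lemma spoiler_wins_left_moveI:
  assumes "spoiler_move on_top A f"
    and "spoiler_wins on_top r (after_spoiler A f) (after_all_copies B)"
  shows "spoiler_wins on_top (Suc r) A B"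
proof -
  have "spoiler_wins on_top r (after_spoiler A f) (after_duplicator B g)"
    if "duplicator_move B g" for g
  proof (rule spoiler_wins_mono[OF assms(2) order_refl])
    show "after_duplicator B g \<subseteq> after_all_copies B"
      using that by (fastforce simp: duplicator_move_def after_duplicator_def after_all_copies_def)
    show "\<forall>p\<in>after_spoiler A f. univ (fst p) \<noteq> {}"
      using assms(1) by (auto simp: spoiler_move_def after_spoiler_def)
    show "\<forall>q\<in>after_all_copies B. univ (fst q) \<noteq> {}"
      by (auto simp: after_duplicator_def after_all_copies_def)
  qed
  then show ?thesis using assms(1) by auto
qed

lemma spoiler_wins_right_moveI:
  assumes "spoiler_move on_top B f"
    and "spoiler_wins on_top r (after_all_copies A) (after_spoiler B f)"
  shows "spoiler_wins on_top (Suc r) A B"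
  using spoiler_wins_left_moveI[OF assms(1)] assms(2) spoiler_wins_commute by blast

section \<open>Transfer of prenex sentences by blocks of quantifiers\<close>

definition expand_blocks :: "(quant \<times> nat) list \<Rightarrow> quant list" where
  "expand_blocks blocks = concat (map (\<lambda>(Q, n). replicate n Q) blocks)"

lemma expand_blocks_simps [simp]:
  "expand_blocks [] = []"
  "expand_blocks ((Q, n) # blocks) = replicate n Q @ expand_blocks blocks"
  by (simp_all add: expand_blocks_def)

text \<open>A block has to be answered as a whole. Answering quantifier by quantifier is stronger, and
  too strong here: three existential quantifiers of \<open>RT4\<close> cannot be answered in \<open>RT3\<close> that way,
  as \<open>B12\<close>, \<open>B21\<close>, \<open>B11\<close> and \<open>B12\<close>, \<open>B11\<close>, \<open>B13\<close> call for different answers to \<open>B12\<close>.\<close>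

fun block_transfer ::
    "'a bstruct \<Rightarrow> 'a list \<Rightarrow> 'b bstruct \<Rightarrow> 'b list \<Rightarrow> (quant \<times> nat) list \<Rightarrow> bool" where
  "block_transfer S as T bs [] \<longleftrightarrow> matching_pair (S, as) (T, bs)"
| "block_transfer S as T bs ((Exists, n) # blocks) \<longleftrightarrow>
     (\<forall>as'\<in>nlists n (univ S). \<exists>bs'\<in>nlists n (univ T). block_transfer S (as @ as') T (bs @ bs') blocks)"
| "block_transfer S as T bs ((Forall, n) # blocks) \<longleftrightarrow>
     (\<forall>bs'\<in>nlists n (univ T). \<exists>as'\<in>nlists n (univ S). block_transfer S (as @ as') T (bs @ bs') blocks)"

lemma bex_nlists_Suc: "(\<exists>xs\<in>nlists (Suc n) A. P xs) \<longleftrightarrow> (\<exists>x\<in>A. \<exists>xs\<in>nlists n A. P (x # xs))"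
  by (auto simp: nlists_Suc)

lemma ball_nlists_Suc: "(\<forall>xs\<in>nlists (Suc n) A. P xs) \<longleftrightarrow> (\<forall>x\<in>A. \<forall>xs\<in>nlists n A. P (x # xs))"
  by (auto simp: nlists_Suc)

lemma holds_prenex_replicate_Exists:
  "holds_prenex S as (replicate n Exists @ Qs) \<theta> \<longleftrightarrow>
     (\<exists>as'\<in>nlists n (univ S). holds_prenex S (as @ as') Qs \<theta>)"
  by (induction n arbitrary: as) (simp_all add: bex_nlists_Suc)

lemma holds_prenex_replicate_Forall:
  "holds_prenex S as (replicate n Forall @ Qs) \<theta> \<longleftrightarrow>
     (\<forall>as'\<in>nlists n (univ S). holds_prenex S (as @ as') Qs \<theta>)"
  by (induction n arbitrary: as) (simp_all add: ball_nlists_Suc)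

lemma holds_prenex_block_transfer:
  assumes "block_transfer S as T bs blocks"
    and "\<theta> \<subseteq> types (length as + length (expand_blocks blocks))"
    and "holds_prenex S as (expand_blocks blocks) \<theta>"
  shows "holds_prenex T bs (expand_blocks blocks) \<theta>"
  using assms
proof (induction S as T bs blocks rule: block_transfer.induct)
  case (1 S as T bs)
  then show ?case using matching_pair_holds_conj by fastforce
next
  case (2 S as T bs n blocks)
  then obtain as' where as': "as' \<in> nlists n (univ S)"
    and holds: "holds_prenex S (as @ as') (expand_blocks blocks) \<theta>"
    by (auto simp: holds_prenex_replicate_Exists)
  obtain bs' where bs': "bs' \<in> nlists n (univ T)"
    and "block_transfer S (as @ as') T (bs @ bs') blocks"
    using "2.prems"(1) as' by auto
  then have "holds_prenex T (bs @ bs') (expand_blocks blocks) \<theta>"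
    using "2.IH"[OF as' bs'] "2.prems"(2) holds as' by (simp add: add.assoc)
  then show ?case using bs' by (auto simp: holds_prenex_replicate_Exists)
next
  case (3 S as T bs n blocks)
  have "holds_prenex T (bs @ bs') (expand_blocks blocks) \<theta>" if bs': "bs' \<in> nlists n (univ T)" for bs'
  proof -
    obtain as' where as': "as' \<in> nlists n (univ S)"
      and "block_transfer S (as @ as') T (bs @ bs') blocks"
      using "3.prems"(1) bs' by auto
    moreover have "holds_prenex S (as @ as') (expand_blocks blocks) \<theta>"
      using "3.prems"(3) as' by (simp add: holds_prenex_replicate_Forall)
    ultimately show ?thesis
      using "3.IH"[OF bs' as'] "3.prems"(2) by (simp add: add.assoc)
  qed
  then show ?case by (simp add: holds_prenex_replicate_Forall)
qed

lemma not_separating_if_block_transfer: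
  assumes "is_sentence r \<psi>" and "prefix \<psi> = expand_blocks blocks"
    and "block_transfer S [] T [] blocks" and "S \<in> \<A>" and "T \<in> \<B>"
  shows "\<not> separating \<psi> \<A> \<B>"
proof -
  have "matrix \<psi> \<subseteq> types (length (expand_blocks blocks))"
    using assms(1,2) by (auto simp: is_sentence_def)
  then have "models T \<psi>" if "models S \<psi>"
    using holds_prenex_block_transfer[OF assms(3)] that assms(2) by (simp add: models_def)
  then show ?thesis using assms(4,5) by (auto simp: separating_def)
qed

lemma block_transfer_single_quantifier:
  "block_transfer S as T bs ((Exists, 1) # blocks) \<longleftrightarrow>
     (\<forall>x\<in>univ S. \<exists>y\<in>univ T. block_transfer S (as @ [x]) T (bs @ [y]) blocks)"
  "block_transfer S as T bs ((Forall, 1) # blocks) \<longleftrightarrow>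
     (\<forall>y\<in>univ T. \<exists>x\<in>univ S. block_transfer S (as @ [x]) T (bs @ [y]) blocks)"
  by (simp_all add: bex_nlists_Suc ball_nlists_Suc)

lemma block_transfer_last_Exists:
  assumes "\<And>X. X \<subseteq> univ S \<Longrightarrow> card X \<le> n \<Longrightarrow>
      \<exists>f. partial_embedding S T (set as \<union> X) f \<and> map f as = bs \<and> f ` X \<subseteq> univ T"
  shows "block_transfer S as T bs [(Exists, n)]"
proof -
  have "\<exists>bs'\<in>nlists n (univ T). matching_pair (S, as @ as') (T, bs @ bs')"
    if "as' \<in> nlists n (univ S)" for as'
  proof -
    have as': "set as' \<subseteq> univ S" "length as' = n" using that by simp_all
    have "card (set as') \<le> n" using card_length[of as'] as'(2) by simp
    from assms[OF as'(1) this] obtain f where f: "partial_embedding S T (set as \<union> set as') f"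
      and images: "map f as = bs" "f ` set as' \<subseteq> univ T"
      by blast
    show ?thesis
    proof
      show "map f as' \<in> nlists n (univ T)"
        using as'(2) images(2) by (intro nlistsI) simp_all
      show "matching_pair (S, as @ as') (T, bs @ map f as')"
        using f images(1) unfolding matching_pair_iff by (intro exI[of _ f]) simp
    qed
  qed
  then show ?thesis by simp
qed

lemma block_transfer_last_Forall:
  assumes "partial_embedding T S (set bs \<union> univ T) e" and "map e bs = as"
    and "e ` univ T \<subseteq> univ S"
  shows "block_transfer S as T bs [(Forall, n)]"
proof -
  have "\<exists>as'\<in>nlists n (univ S). matching_pair (S, as @ as') (T, bs @ bs')"
    if "bs' \<in> nlists n (univ T)" for bs'
  proof
    have bs': "set bs' \<subseteq> univ T" "length bs' = n" using that by simp_all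
    then have "set (map e bs') \<subseteq> univ S" using assms(3) by auto
    then show "map e bs' \<in> nlists n (univ S)" using bs'(2) by (intro nlistsI) simp_all
    have "set (bs @ bs') \<subseteq> set bs \<union> univ T" using bs'(1) by auto
    from partial_embedding_subset[OF assms(1) this]
    have "matching_pair (T, bs @ bs') (S, as @ map e bs')"
      unfolding matching_pair_iff by (intro exI[of _ e]) (simp add: assms(2))
    then show "matching_pair (S, as @ map e bs') (T, bs @ bs')" by (rule matching_pair_sym)
  qed
  then show ?thesis by simp
qed

section \<open>Non-replicating sentences\<close>

lemma non_replicating_type_EqD:
  assumes "non_replicating_type \<psi> t" and "Pos (Eq i j) \<in> t" and "i < j"
  shows "prefix \<psi> ! j = Forall"
  using assms unfolding non_replicating_type_def by (metis less_asym less_irrefl)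

lemma non_replicating_Eq_in_matrix_iff:
  assumes "is_sentence r \<psi>" and "non_replicating \<psi>" and "non_replicating (neg_sentence \<psi>)"
    and "t \<in> types r" and "Pos (Eq i j) \<in> t" and "i < j" and "j < r"
  shows "t \<in> matrix \<psi> \<longleftrightarrow> prefix \<psi> ! j = Forall"
proof (cases "t \<in> matrix \<psi>")
  case True
  then have "non_replicating_type \<psi> t" using assms(2) by (simp add: non_replicating_def)
  then show ?thesis using True non_replicating_type_EqD assms(5,6) by blast
next
  case False
  have len: "length (prefix \<psi>) = r" using assms(1) by (simp add: is_sentence_def)
  then have "t \<in> matrix (neg_sentence \<psi>)" using False assms(4) by (simp add: neg_sentence_def)
  then have "non_replicating_type (neg_sentence \<psi>) t"
    using assms(3) by (simp add: non_replicating_def)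
  then have "prefix (neg_sentence \<psi>) ! j = Forall"
    using non_replicating_type_EqD assms(5,6) by blast
  then have "prefix \<psi> ! j \<noteq> Forall" using len assms(7) by (auto simp: neg_sentence_def)
  then show ?thesis using False by simp
qed

definition all_equal_type :: "nat \<Rightarrow> literal set" where
  "all_equal_type r = {Pos (Eq i j) | i j. i < r \<and> j < r} \<union> {Neg (Less i j) | i j. i < r \<and> j < r}"

lemma all_equal_type_in_types: "all_equal_type r \<in> types r"
proof -
  let ?S = "\<lparr>univ = UNIV, lt = (\<lambda>_ _. False)\<rparr> :: nat bstruct"
  have "holds_conj ?S (replicate r 0) (all_equal_type r)"
    by (auto simp: holds_conj_def all_equal_type_def)
  then have "consistent r (all_equal_type r)"
    unfolding consistent_def by (intro exI[of _ ?S] exI[of _ "replicate r 0"]) simp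
  then show ?thesis by (auto simp: types_def atoms_def all_equal_type_def)
qed

lemma non_replicating_quantifiers_equal:
  assumes "is_sentence r \<psi>" and "non_replicating \<psi>" and "non_replicating (neg_sentence \<psi>)"
    and "0 < i" "i < r" "0 < j" "j < r"
  shows "prefix \<psi> ! i = prefix \<psi> ! j"
proof -
  have "all_equal_type r \<in> matrix \<psi> \<longleftrightarrow> prefix \<psi> ! k = Forall" if "0 < k" "k < r" for k
  proof (rule non_replicating_Eq_in_matrix_iff[OF assms(1-3) all_equal_type_in_types])
    show "Pos (Eq 0 k) \<in> all_equal_type r" using that by (simp add: all_equal_type_def)
  qed (use that in auto)
  then have "prefix \<psi> ! i = Forall \<longleftrightarrow> prefix \<psi> ! j = Forall"
    using assms(4-7) by blast
  then show ?thesis by (cases "prefix \<psi> ! i"; cases "prefix \<psi> ! j") simp_all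
qed

section \<open>Embeddings between the two trees\<close>

fun ancestors4 :: "node4 \<Rightarrow> node4 set" where
  "ancestors4 B1 = {}"
| "ancestors4 B11 = {B1}"
| "ancestors4 B12 = {B1, B11}"
| "ancestors4 B13 = {B1, B11, B12}"
| "ancestors4 B21 = {B1}"
| "ancestors4 B22 = {B1, B21}"

fun ancestors3 :: "node3 \<Rightarrow> node3 set" where
  "ancestors3 L1 = {}"
| "ancestors3 L11 = {L1}"
| "ancestors3 L12 = {L1, L11}"
| "ancestors3 L21 = {L1}"
| "ancestors3 L22 = {L1, L21}"

lemma univ_trees [simp]: "univ RT4 = UNIV" "univ RT3 = UNIV"
  by (simp_all add: RT4_def RT3_def)

lemma lt_RT4 [simp]: "lt RT4 x y \<longleftrightarrow> y \<in> ancestors4 x"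
  by (cases x) (auto simp: RT4_def child4_def trancl_insert2)

lemma lt_RT3 [simp]: "lt RT3 x y \<longleftrightarrow> y \<in> ancestors3 x"
  by (cases x) (auto simp: RT3_def child3_def trancl_insert2)

fun spread :: "node4 \<Rightarrow> node3 \<Rightarrow> node4" where
  "spread u L1 = B1"
| "spread u L11 = u"
| "spread u L12 = B13"
| "spread u L21 = B21"
| "spread u L22 = B22"

lemma partial_embedding_spread:
  assumes "u \<in> {B11, B12}"
  shows "partial_embedding RT3 RT4 UNIV (spread u)"
  unfolding partial_embedding_def
proof (intro conjI ballI)
  show "inj (spread u)"
  proof (rule injI)
    show "x = y" if "spread u x = spread u y" for x y
      using assms that by (cases x; cases y) auto
  qed
  show "lt RT4 (spread u x) (spread u y) \<longleftrightarrow> lt RT3 x y" for x y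
    using assms by (cases x; cases y) auto
qed

lemma RT3_embeds_through: "\<exists>e y. partial_embedding RT3 RT4 UNIV e \<and> e y = x"
proof -
  have "\<exists>u\<in>{B11, B12}. x \<in> {spread u L1, spread u L11, spread u L12, spread u L21, spread u L22}"
    by (cases x) auto
  then show ?thesis using partial_embedding_spread by blast
qed

text \<open>The node \<open>c\<close> stands for the missing element of the chain \<open>B11\<close>, \<open>B12\<close>, \<open>B13\<close>, so its own
  image is irrelevant.\<close>

fun collapse :: "node4 \<Rightarrow> node4 \<Rightarrow> node3" where
  "collapse c B1 = L1"
| "collapse c B11 = L11"
| "collapse c B12 = (if c = B11 then L11 else L12)"
| "collapse c B13 = L12"
| "collapse c B21 = L21"
| "collapse c B22 = L22"

lemma partial_embedding_collapse:
  assumes "c \<in> {B11, B12, B13}"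
  shows "partial_embedding RT4 RT3 (- {c}) (collapse c)"
  unfolding partial_embedding_def
proof (intro conjI ballI inj_onI)
  show "x = y" if "x \<in> - {c}" "y \<in> - {c}" "collapse c x = collapse c y" for x y
    using assms that by (cases x; cases y) auto
  show "lt RT3 (collapse c x) (collapse c y) \<longleftrightarrow> lt RT4 x y" if "x \<in> - {c}" "y \<in> - {c}" for x y
    using assms that by (cases x; cases y) auto
qed

lemma finite_node4_set: "finite (X :: node4 set)"
proof (rule finite_subset)
  show "X \<subseteq> {B1, B11, B12, B13, B21, B22}" using node4.exhaust by blast
qed simp

lemma at_most_three_nodes_embed:
  assumes "card X \<le> 3"
  shows "\<exists>f. partial_embedding RT4 RT3 X f"
proof (cases "{B11, B12, B13} \<subseteq> X")
  case True
  then have "X = {B11, B12, B13}"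
    using assms card_seteq[OF finite_node4_set, of "{B11, B12, B13}" X] by simp
  then have "partial_embedding RT4 RT3 X (case_node4 L1 L1 L11 L12 L1 L1)"
    by (auto simp: partial_embedding_def)
  then show ?thesis by blast
next
  case False
  then obtain c where "c \<in> {B11, B12, B13}" and "X \<subseteq> - {c}" by blast
  then show ?thesis using partial_embedding_collapse partial_embedding_subset by blast
qed

fun mirror :: "node3 \<Rightarrow> node3" where
  "mirror L1 = L1"
| "mirror L11 = L21"
| "mirror L12 = L22"
| "mirror L21 = L11"
| "mirror L22 = L12"

lemma partial_embedding_mirror: "partial_embedding RT3 RT3 UNIV mirror"
  unfolding partial_embedding_def
proof (intro conjI ballI)
  have "mirror (mirror x) = x" for x by (cases x) simp_all
  then show "inj mirror" by (rule inj_on_inverseI)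
  show "lt RT3 (mirror x) (mirror y) \<longleftrightarrow> lt RT3 x y" for x y
    by (cases x; cases y) simp_all
qed

lemma collapse_onto_up_to_automorphism:
  "\<exists>x\<in>{B1, B21, B22}. \<exists>m. partial_embedding RT3 RT3 UNIV m \<and> (\<forall>c. m (collapse c x) = y)"
proof -
  have id: "partial_embedding RT3 RT3 UNIV id" by (simp add: partial_embedding_def)
  have "(\<exists>x\<in>{B1, B21, B22}. \<forall>c. id (collapse c x) = y) \<or>
      (\<exists>x\<in>{B1, B21, B22}. \<forall>c. mirror (collapse c x) = y)"
    by (cases y) simp_all
  then show ?thesis using id partial_embedding_mirror by meson
qed

lemma at_most_two_nodes_embed_with_preimage:
  "\<exists>x. \<forall>X. card X \<le> 2 \<longrightarrow> (\<exists>f. partial_embedding RT4 RT3 (insert x X) f \<and> f x = y)"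
proof -
  obtain x m where x: "x \<in> {B1, B21, B22}" and m: "partial_embedding RT3 RT3 UNIV m"
    and onto: "\<And>c. m (collapse c x) = y"
    using collapse_onto_up_to_automorphism by blast
  have "\<exists>f. partial_embedding RT4 RT3 (insert x X) f \<and> f x = y" if "card X \<le> 2" for X
  proof -
    have "\<not> {B11, B12, B13} \<subseteq> X"
      using card_mono[OF finite_node4_set, of "{B11, B12, B13}" X] that by auto
    then obtain c where c: "c \<in> {B11, B12, B13}" and "insert x X \<subseteq> - {c}" using x by blast
    then have "partial_embedding RT4 RT3 (insert x X) (collapse c)"
      by (intro partial_embedding_subset[OF partial_embedding_collapse[OF c]])
    then have "partial_embedding RT4 RT3 (insert x X) (m \<circ> collapse c)"
      by (rule partial_embedding_comp) (rule partial_embedding_subset[OF m subset_UNIV])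
    moreover have "(m \<circ> collapse c) x = y" using onto by simp
    ultimately show ?thesis by blast
  qed
  then show ?thesis by blast
qed

lemma block_transfer_trees:
  "block_transfer RT4 [] RT3 [] [(Exists, 3)]"
  "block_transfer RT4 [] RT3 [] [(Forall, 3)]"
  "block_transfer RT4 [] RT3 [] [(Forall, 1), (Exists, 2)]"
  "block_transfer RT4 [] RT3 [] [(Exists, 1), (Forall, 2)]"
proof -
  show "block_transfer RT4 [] RT3 [] [(Exists, 3)]"
    by (rule block_transfer_last_Exists) (simp add: at_most_three_nodes_embed)
  obtain e where "partial_embedding RT3 RT4 UNIV e" using RT3_embeds_through by blast
  then show "block_transfer RT4 [] RT3 [] [(Forall, 3)]"
    by (intro block_transfer_last_Forall) simp_all
  have "\<exists>x. block_transfer RT4 [x] RT3 [y] [(Exists, 2)]" for y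
  proof -
    obtain x where "\<And>X. card X \<le> 2 \<Longrightarrow> \<exists>f. partial_embedding RT4 RT3 (insert x X) f \<and> f x = y"
      using at_most_two_nodes_embed_with_preimage by blast
    then have "block_transfer RT4 [x] RT3 [y] [(Exists, 2)]"
      by (intro block_transfer_last_Exists) simp
    then show ?thesis ..
  qed
  then show "block_transfer RT4 [] RT3 [] [(Forall, 1), (Exists, 2)]"
    unfolding block_transfer_single_quantifier univ_trees append_Nil by blast
  have "\<exists>y. block_transfer RT4 [x] RT3 [y] [(Forall, 2)]" for x
  proof -
    obtain e y where "partial_embedding RT3 RT4 UNIV e" and "e y = x"
      using RT3_embeds_through by blast
    then have "block_transfer RT4 [x] RT3 [y] [(Forall, 2)]"
      by (intro block_transfer_last_Forall[where e = e]) simp_all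
    then show ?thesis ..
  qed
  then show "block_transfer RT4 [] RT3 [] [(Exists, 1), (Forall, 2)]"
    unfolding block_transfer_single_quantifier univ_trees append_Nil by blast
qed

lemma not_separating_if_last_quantifiers_equal:
  assumes "is_sentence 3 \<psi>" and "prefix \<psi> ! 1 = prefix \<psi> ! 2"
  shows "\<not> separating \<psi> {RT4} {RT3}"
proof -
  have "length (prefix \<psi>) = 3" using assms(1) by (simp add: is_sentence_def)
  then obtain Q R where prefix: "prefix \<psi> = [Q, R, R]"
    using assms(2) by (auto simp: numeral_3_eq_3 length_Suc_conv)
  have "\<exists>blocks. prefix \<psi> = expand_blocks blocks \<and> block_transfer RT4 [] RT3 [] blocks"
  proof (cases "Q = R")
    case True
    then have "prefix \<psi> = expand_blocks [(R, 3)]" by (simp add: prefix numeral_3_eq_3)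
    then show ?thesis using block_transfer_trees(1,2) by (cases R) metis+
  next
    case False
    have "prefix \<psi> = expand_blocks [(Q, 1), (R, 2)]" by (simp add: prefix numeral_2_eq_2)
    then show ?thesis using False block_transfer_trees(3,4) by (cases Q; cases R) metis+
  qed
  then show ?thesis using not_separating_if_block_transfer[OF assms(1)] by blast
qed

section \<open>Spoiler's strategy\<close>

fun second_move :: "node3 \<Rightarrow> node3" where
  "second_move L1 = L11"
| "second_move L11 = L1"
| "second_move L12 = L21"
| "second_move L21 = L1"
| "second_move L22 = L11"

fun third_move :: "node4 \<Rightarrow> node4" where
  "third_move B1 = B11"
| "third_move B21 = B13"
| "third_move B22 = B13"
| "third_move _ = B1"

lemma not_matching_pair_after_strategy:
  "\<not> matching_pair (RT4, [B12, y, third_move y]) (RT3, [x, second_move x, z])"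
proof
  assume "matching_pair (RT4, [B12, y, third_move y]) (RT3, [x, second_move x, z])"
  then obtain f where images: "f B12 = x" "f y = second_move x" "f (third_move y) = z"
    and f: "partial_embedding RT4 RT3 {B12, y, third_move y} f"
    by (auto simp: matching_pair_iff)
  have equal: "x = second_move x \<longleftrightarrow> B12 = y"
    using f images unfolding partial_embedding_def by (metis inj_on_eq_iff insertCI)
  have order: "lt RT3 (f u) (f v) \<longleftrightarrow> lt RT4 u v"
    if "u \<in> {B12, y, third_move y}" "v \<in> {B12, y, third_move y}" for u v
    using f that unfolding partial_embedding_def by blast
  consider (below) "x = L1" "y = B13"
    | (above) "x \<in> {L11, L21}" "y \<in> {B1, B11}"
    | (incomparable) "x \<in> {L12, L22}" "y \<in> {B21, B22}"
    using equal order[of B12 y] order[of y B12] unfolding images by (cases x; cases y; simp)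
  then show False
  proof cases
    case below
    then show False using order[of B12 "third_move y"] by (simp add: images)
  next
    case above
    then show False
      using order[of B12 "third_move y"] order[of y "third_move y"] order[of "third_move y" y]
      unfolding images by (cases z) auto
  next
    case incomparable
    then show False using order[of "third_move y" B12] unfolding images by (cases z) auto
  qed
qed

lemma spoiler_wins_third_round:
  "spoiler_wins False 1 (range (\<lambda>y. (RT4, [B12, y]))) (range (\<lambda>x. (RT3, [x, second_move x])))"
  (is "spoiler_wins _ _ ?A ?B")
  unfolding One_nat_def
proof (rule spoiler_wins_left_moveI)
  let ?f = "\<lambda>p. third_move (last (snd p))"
  have "third_move y \<noteq> y" "third_move y \<noteq> B12" for y by (cases y; simp)+
  then show "spoiler_move False ?A ?f" by (auto simp: spoiler_move_def)
  show "spoiler_wins False 0 (after_spoiler ?A ?f) (after_all_copies ?B)"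
    by (auto simp: no_match_def after_spoiler_def after_all_copies_def after_duplicator_def
        not_matching_pair_after_strategy)
qed

lemma spoiler_wins_second_round:
  "spoiler_wins False 2 {(RT4, [B12])} (range (\<lambda>x. (RT3, [x])))"
  (is "spoiler_wins _ _ ?A ?B")
  unfolding numeral_2_eq_2
proof (rule spoiler_wins_right_moveI)
  let ?f = "\<lambda>p. second_move (last (snd p))"
  have "second_move x \<noteq> x" for x by (cases x) simp_all
  then show "spoiler_move False ?B ?f" by (auto simp: spoiler_move_def)
  have "after_all_copies ?A = range (\<lambda>y. (RT4, [B12, y]))"
    by (auto simp: after_all_copies_def after_duplicator_def)
  moreover have "after_spoiler ?B ?f = range (\<lambda>x. (RT3, [x, second_move x]))"
    by (auto simp: after_spoiler_def)
  ultimately show "spoiler_wins False (Suc 0) (after_all_copies ?A) (after_spoiler ?B ?f)"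
    using spoiler_wins_third_round by simp
qed

lemma spoiler_wins_trees: "spoiler_can_win_without_top 3 {RT4} {RT3}"
  unfolding spoiler_can_win_without_top_def numeral_3_eq_3
proof (rule spoiler_wins_left_moveI)
  let ?f = "\<lambda>_. B12"
  show "spoiler_move False (initial {RT4}) ?f"
    by (simp add: spoiler_move_def initial_def)
  have "after_spoiler (initial {RT4}) ?f = {(RT4, [B12])}"
    by (simp add: after_spoiler_def initial_def)
  moreover have "after_all_copies (initial {RT3}) = range (\<lambda>x. (RT3, [x]))"
    by (auto simp: after_all_copies_def after_duplicator_def initial_def)
  ultimately show "spoiler_wins False (Suc (Suc 0)) (after_spoiler (initial {RT4}) ?f)
      (after_all_copies (initial {RT3}))"
    using spoiler_wins_second_round by (simp add: numeral_2_eq_2)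
qed

theorem theorem4p10:
  shows "spoiler_can_win_without_top 3 {RT4} {RT3} \<and>
    \<not> (\<exists>\<psi>. is_sentence 3 \<psi> \<and> separating \<psi> {RT4} {RT3} \<and>
            non_replicating \<psi> \<and> non_replicating (neg_sentence \<psi>))"
proof (intro conjI notI)
  show "spoiler_can_win_without_top 3 {RT4} {RT3}" by (rule spoiler_wins_trees)
next
  assume "\<exists>\<psi>. is_sentence 3 \<psi> \<and> separating \<psi> {RT4} {RT3} \<and>
            non_replicating \<psi> \<and> non_replicating (neg_sentence \<psi>)"
  then obtain \<psi> where sentence: "is_sentence 3 \<psi>" and separating: "separating \<psi> {RT4} {RT3}"
    and non_replicating: "non_replicating \<psi>" "non_replicating (neg_sentence \<psi>)"
    by blast
  have "prefix \<psi> ! 1 = prefix \<psi> ! 2"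
    by (rule non_replicating_quantifiers_equal[OF sentence non_replicating]) simp_all
  then show False
    using not_separating_if_last_quantifiers_equal[OF sentence] separating by blast
qed

end
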